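(* Let $d\ge2$ and let $f:(0,\infty)\to\mathbb{R}$ be convex with $f(1)=0$. The $f$-divergence $D_f[p_\theta:p_{\theta'}]$ between hyperboloid distributions, $\theta,\theta'\in\Theta_{\mathbb{L}^d}$, is invariant with respect to the action of $\mathrm{SO}_0(1,d)$, i.e. $D_f[p_{A\theta}:p_{A\theta'}]=D_f[p_\theta:p_{\theta'}]$ for all $A\in\mathrm{SO}_0(1,d)$, and it is a function of the triplet $\left([\theta,\theta],[\theta',\theta'],[\theta,\theta']\right)$ (that is, there is a function $\Phi_f$ such that $D_f[p_\theta:p_{\theta'}]=\Phi_f([\theta,\theta],[\theta',\theta'],[\theta,\theta'])$ for all $\theta,\theta'\in\Theta_{\mathbb{L}^d}$).
   Context: The Minkowski inner product on $\mathbb{R}^{d+1}$ is $[x,y]=x_0y_0-x_1y_1-\cdots-x_dy_d$. $\mathbb{L}^d=\{x\in\mathbb{R}^{d+1}:x_0=\sqrt{1+x_1^2+\cdots+x_d^2}\}$, $\Theta_{\mathbb{L}^d}=\{\theta\in\mathbb{R}^{d+1}:\theta_0>\sqrt{\theta_1^2+\cdots+\theta_d^2}\}$, and $|\theta|=[\theta,\theta]^{1/2}$ for $\theta\in\Theta_{\mathbb{L}^d}$. For $x\in\mathbb{R}^d$ let $\widetilde x=\left(\sqrt{1+\sum_i x_i^2},x_1,\dots,x_d\right)\in\mathbb{L}^d$. The hyperboloid distribution with parameter $\theta\in\Theta_{\mathbb{L}^d}$ is the probability distribution on $\mathbb{R}^d$ with Lebesgue density $$p_\theta(x)=c_d(|\theta|)\,\frac{\exp(-[\theta,\widetilde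 x])}{\sqrt{1+\sum_i x_i^2}},\qquad c_d(t)=\frac{t^{(d-1)/2}}{2(2\pi)^{(d-1)/2}K_{(d-1)/2}(t)},\ t>0,$$ where $K_\nu$ is the modified Bessel function of the second kind. The $f$-divergence is $D_f[p:q]=\int_{\mathbb{R}^d}p\,f(q/p)\,dx\in[0,+\infty]$. $\mathrm{SO}(1,d)=\{A\in\mathrm{SL}(d+1,\mathbb{R}):[Ax,Ay]=[x,y]\ \forall x,y\in\mathbb{R}^{d+1}\}$ and $\mathrm{SO}_0(1,d)=\{A\in\mathrm{SO}(1,d):A(\mathbb{L}^d)=\mathbb{L}^d\}$. *)

theory Defs
  imports "HOL-Analysis.Analysis"
begin

(* The d + 1 coordinates of Minkowski space are indexed by 'd option with CARD('d) = d:
   None is the coordinate 0 and Some i are the remaining d coordinates. *)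

type_synonym 'd mink_vec = "(real, 'd option) vec"
type_synonym 'd mink_mat = "((real, 'd option) vec, 'd option) vec"

definition mink :: "'d::finite mink_vec \<Rightarrow> 'd mink_vec \<Rightarrow> real" where
  "mink x y = x $ None * y $ None - (\<Sum>i\<in>UNIV. x $ Some i * y $ Some i)"

definition hyperboloid :: "('d::finite mink_vec) set" where
  "hyperboloid = {x. x $ None = sqrt (1 + (\<Sum>i\<in>UNIV. (x $ Some i)\<^sup>2))}"

definition Theta :: "('d::finite mink_vec) set" where
  "Theta = {\<theta>. \<theta> $ None > sqrt (\<Sum>i\<in>UNIV. (\<theta> $ Some i)\<^sup>2)}"

definition mink_norm :: "'d::finite mink_vec \<Rightarrow> real" where
  "mink_norm \<theta> = sqrt (mink \<theta> \<theta>)"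

definition lift :: "real ^ 'd::finite \<Rightarrow> 'd mink_vec" where
  "lift x = (\<chi> j. case j of None \<Rightarrow> sqrt (1 + (\<Sum>i\<in>UNIV. (x $ i)\<^sup>2)) | Some i \<Rightarrow> x $ i)"

(* Modified Bessel functions of real order and argument t > 0. In the power series of the first
   kind, rGamma is the reciprocal Gamma function, which vanishes at the poles of Gamma. The second
   kind is given by the usual formula with sin (\<nu> * pi) in the denominator, understood as a limit
   in the order when \<nu> is an integer. *)

definition Bessel_I :: "real \<Rightarrow> real \<Rightarrow> real" where
  "Bessel_I \<nu> t = (\<Sum>k. (t / 2) powr (2 * real k + \<nu>) * rGamma (real k + \<nu> + 1) / fact k)"

definition Bessel_K :: "real \<Rightarrow> real \<Rightarrow> real" where
  "Bessel_K \<nu> t =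
     (let F = (\<lambda>\<mu>. pi / 2 * (Bessel_I (- \<mu>) t - Bessel_I \<mu> t) / sin (\<mu> * pi))
      in if \<nu> \<in> \<int> then Lim (at \<nu>) F else F \<nu>)"

definition hyperboloid_const :: "nat \<Rightarrow> real \<Rightarrow> real" where
  "hyperboloid_const d t =
     t powr ((real d - 1) / 2) /
     (2 * (2 * pi) powr ((real d - 1) / 2) * Bessel_K ((real d - 1) / 2) t)"

definition hyperboloid_density :: "'d::finite mink_vec \<Rightarrow> real ^ 'd \<Rightarrow> real" where
  "hyperboloid_density \<theta> x =
     hyperboloid_const CARD('d) (mink_norm \<theta>) *
     (exp (- mink \<theta> (lift x)) / sqrt (1 + (\<Sum>i\<in>UNIV. (x $ i)\<^sup>2)))"

(* The integral of p f(q/p) in the extended reals, as the integral of the positive part minus that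
   of the negative part (ennreal maps negative reals to 0). For convex f and probability densities
   the negative part has finite integral, since f is bounded below by an affine function, so the
   difference is never of the form \<infinity> - \<infinity>. *)

definition f_divergence ::
  "(real \<Rightarrow> real) \<Rightarrow> ('a::euclidean_space \<Rightarrow> real) \<Rightarrow> ('a \<Rightarrow> real) \<Rightarrow> ereal" where
  "f_divergence f p q =
     enn2ereal (\<integral>\<^sup>+ x. ennreal (p x * f (q x / p x)) \<partial>lborel) -
     enn2ereal (\<integral>\<^sup>+ x. ennreal (- (p x * f (q x / p x))) \<partial>lborel)"

definition SO_1d :: "('d::finite mink_mat) set" where
  "SO_1d = {A. det A = 1 \<and> (\<forall>x y. mink (A *v x) (A *v y) = mink x y)}"

definition SO0_1d :: "('d::finite mink_mat) set" where
  "SO0_1d = {A \<in> SO_1d. (\<lambda>x. A *v x) ` hyperboloid = hyperboloid}"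

lemma mink_scaleR: "mink (c *\<^sub>R x) (c *\<^sub>R y) = c\<^sup>2 * mink x y"
  by (simp add: mink_def power2_eq_square algebra_simps sum_distrib_left)

lemma Theta_iff: "\<theta> \<in> Theta \<longleftrightarrow> \<theta> $ None > 0 \<and> mink \<theta> \<theta> > 0"
proof -
  define s where "s = (\<Sum>i\<in>UNIV. (\<theta> $ Some i)\<^sup>2)"
  have "0 \<le> s" by (simp add: s_def sum_nonneg)
  then have "sqrt s < \<theta> $ None \<longleftrightarrow> \<theta> $ None > 0 \<and> s < (\<theta> $ None)\<^sup>2"
    by (metis real_less_lsqrt real_sqrt_ge_zero real_sqrt_less_iff real_sqrt_abs abs_of_pos
        order_le_less_trans)
  then show ?thesis
    by (simp add: Theta_def mink_def s_def flip: power2_eq_square)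
qed

lemma hyperboloid_iff: "x \<in> hyperboloid \<longleftrightarrow> x $ None > 0 \<and> mink x x = 1"
proof -
  have *: "0 < 1 + (\<Sum>i\<in>UNIV. (x $ Some i)\<^sup>2)" by (simp add: sum_nonneg add_pos_nonneg)
  show ?thesis
    unfolding hyperboloid_def mink_def
    using * by (auto simp: power2_eq_square[symmetric] algebra_simps intro: real_sqrt_unique[symmetric])
qed

(* The action of SO0_1d on the parameter space is well defined. *)
lemma SO0_1d_Theta:
  assumes "A \<in> SO0_1d" "\<theta> \<in> Theta"
  shows "A *v \<theta> \<in> Theta"
proof -
  define c where "c = mink_norm \<theta>"
  have c: "c > 0" "c\<^sup>2 = mink \<theta> \<theta>"
    using assms(2) by (simp_all add: Theta_iff c_def mink_norm_def)
  have "(1 / c) *\<^sub>R \<theta> \<in> hyperboloid"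
    using assms(2) c by (simp add: Theta_iff hyperboloid_iff mink_scaleR power_divide)
  then have "A *v ((1 / c) *\<^sub>R \<theta>) \<in> hyperboloid"
    using assms(1) unfolding SO0_1d_def by blast
  then have "(A *v \<theta>) $ None > 0"
    using c by (simp add: hyperboloid_iff matrix_vector_mult_scaleR zero_less_divide_iff)
  then show ?thesis
    using assms by (simp add: Theta_iff SO0_1d_def SO_1d_def)
qed

end

theory Submission
  imports Defs
begin

text \<open>
  The measure \<open>dx / sqrt (1 + |x|\<^sup>2)\<close> on the hyperboloid is obtained from Lebesgue measure on the
  solid cone shell \<open>1 \<le> |p| \<le> 2\<close> by integrating out the Minkowski norm, so it is invariant under every
  Minkowski reflection that preserves the future cone, because such a reflection is a linear
  involution and therefore preserves Lebesgue measure. If \<open>a \<noteq> b\<close> are future timelike of equal norm,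
  then \<open>a - b\<close> is spacelike and the reflection along it swaps \<open>a\<close> and \<open>b\<close>. Hence at most two such
  reflections carry \<open>(\<theta>, \<theta>')\<close> to any other pair with the same three Minkowski products: the first one
  matches \<open>\<theta>\<close>, the second one is along a vector orthogonal to the matched \<open>\<theta>\<close> and matches \<open>\<theta>'\<close>.
  The divergence therefore depends on the three products only, and invariance under
  \<open>SO\<^sub>0(1,d)\<close> follows because the group preserves them.
\<close>

section \<open>Lebesgue measure under translations, dilations and linear involutions\<close>

lemma nn_integral_lborel_translate:
  fixes F :: "'a::euclidean_space \<Rightarrow> ennreal"
  assumes [measurable]: "F \<in> borel_measurable borel"
  shows "(\<integral>\<^sup>+ x. F (c + x) \<partial>lborel) = (\<integral>\<^sup>+ x. F x \<partial>lborel)"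
proof -
  have "(\<integral>\<^sup>+ x. F x \<partial>distr lborel borel ((+) c)) = (\<integral>\<^sup>+ x. F (c + x) \<partial>lborel)"
    by (subst nn_integral_distr) auto
  then show ?thesis
    by (simp only: lborel_distr_plus)
qed

lemma nn_integral_lborel_scale:
  fixes F :: "'a::euclidean_space \<Rightarrow> ennreal"
  assumes [measurable]: "F \<in> borel_measurable borel" and c: "c \<noteq> 0"
  shows "(\<integral>\<^sup>+ x. F x \<partial>lborel) = ennreal (\<bar>c\<bar> ^ DIM('a)) * (\<integral>\<^sup>+ x. F (c *\<^sub>R x) \<partial>lborel)"
  by (subst lborel_affine[OF c, of 0])
     (simp add: nn_integral_density nn_integral_distr nn_integral_cmult)

text \<open>
  Integrating \<open>F (A x)\<close> against a bump function \<open>\<phi>\<close> in a second variable and exchanging the two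
  integrals shows that \<open>A\<close> scales Lebesgue measure by a constant; the choice \<open>F = \<phi> \<circ> A\<close> shows
  that its square is \<open>1\<close>.
\<close>
lemma nn_integral_lborel_linear_involution:
  fixes A :: "'a::euclidean_space \<Rightarrow> 'a" and F :: "'a \<Rightarrow> ennreal"
  assumes lin: "linear A" and inv: "\<And>x. A (A x) = x"
    and F: "F \<in> borel_measurable borel"
  shows "(\<integral>\<^sup>+ x. F (A x) \<partial>lborel) = (\<integral>\<^sup>+ x. F x \<partial>lborel)"
proof -
  have Am [measurable]: "A \<in> borel_measurable borel"
    by (intro borel_measurable_continuous_onI linear_continuous_on
        linear_conv_bounded_linear[THEN iffD1] lin)
  define \<phi> :: "'a \<Rightarrow> ennreal" where "\<phi> = indicator (ball 0 1)"
  have [measurable]: "\<phi> \<in> borel_measurable borel"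
    unfolding \<phi>_def by (rule borel_measurable_indicator) simp
  define \<beta> where "\<beta> = (\<integral>\<^sup>+ x. \<phi> x \<partial>lborel)"
  define \<gamma> where "\<gamma> = (\<integral>\<^sup>+ x. \<phi> (A x) \<partial>lborel)"
  have \<beta>: "\<beta> = emeasure lborel (ball (0::'a) 1)"
    by (simp add: \<beta>_def \<phi>_def)
  have \<beta>_fin: "\<beta> < \<infinity>"
    unfolding \<beta> by (rule emeasure_lborel_ball_finite)
  have \<beta>_pos: "\<beta> \<noteq> 0"
    unfolding \<beta> using unit_ball_vol_pos[of "real DIM('a)"]
    by (simp add: emeasure_ball less_imp_neq[symmetric])
  have key: "(\<integral>\<^sup>+ x. F (A x) \<partial>lborel) * \<beta> = (\<integral>\<^sup>+ x. F x \<partial>lborel) * \<gamma>"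
    if F [measurable]: "F \<in> borel_measurable borel" for F
  proof -
    have "(\<integral>\<^sup>+ x. F (A x) \<partial>lborel) * \<beta> = (\<integral>\<^sup>+ y. (\<integral>\<^sup>+ x. F (A x) \<partial>lborel) * \<phi> y \<partial>lborel)"
      by (simp add: \<beta>_def nn_integral_cmult)
    also have "\<dots> = (\<integral>\<^sup>+ y. (\<integral>\<^sup>+ x. F (y + A x) * \<phi> y \<partial>lborel) \<partial>lborel)"
    proof (rule nn_integral_cong)
      fix y :: 'a
      \<comment> \<open>Shifting \<open>x\<close> by \<open>A y\<close> shifts \<open>A x\<close> by
        \<open>y\<close>, as \<open>A\<close> is a linear involution.\<close>
      have "(\<integral>\<^sup>+ x. F (A x) \<partial>lborel) = (\<integral>\<^sup>+ x. F (A (A y + x)) \<partial>lborel)"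
        by (rule nn_integral_lborel_translate[symmetric]) measurable
      then show "(\<integral>\<^sup>+ x. F (A x) \<partial>lborel) * \<phi> y = (\<integral>\<^sup>+ x. F (y + A x) * \<phi> y \<partial>lborel)"
        by (simp add: linear_add[OF lin] inv nn_integral_multc)
    qed
    also have "\<dots> = (\<integral>\<^sup>+ x. (\<integral>\<^sup>+ y. F (y + A x) * \<phi> y \<partial>lborel) \<partial>lborel)"
      by (rule lborel_pair.Fubini') measurable
    also have "\<dots> = (\<integral>\<^sup>+ x. (\<integral>\<^sup>+ y. F y * \<phi> (y - A x) \<partial>lborel) \<partial>lborel)"
    proof (rule nn_integral_cong)
      fix x :: 'a
      show "(\<integral>\<^sup>+ y. F (y + A x) * \<phi> y \<partial>lborel) = (\<integral>\<^sup>+ y. F y * \<phi> (y - A x) \<partial>lborel)"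
        using nn_integral_lborel_translate[of "\<lambda>y. F y * \<phi> (y - A x)" "A x"]
        by (simp add: add.commute)
    qed
    also have "\<dots> = (\<integral>\<^sup>+ y. (\<integral>\<^sup>+ x. F y * \<phi> (y - A x) \<partial>lborel) \<partial>lborel)"
      by (rule lborel_pair.Fubini'[symmetric]) measurable
    also have "\<dots> = (\<integral>\<^sup>+ y. F y * \<gamma> \<partial>lborel)"
    proof (rule nn_integral_cong)
      fix y :: 'a
      have "(\<integral>\<^sup>+ x. \<phi> (y - A x) \<partial>lborel) = (\<integral>\<^sup>+ x. \<phi> (A (- x)) \<partial>lborel)"
        using nn_integral_lborel_translate[of "\<lambda>x. \<phi> (y - A x)" "A y"]
        by (simp add: linear_add[OF lin] linear_neg[OF lin] inv)
      also have "\<dots> = \<gamma>"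
        using nn_integral_lborel_scale[of "\<lambda>x. \<phi> (A x)" "-1"] by (simp add: \<gamma>_def)
      finally show "(\<integral>\<^sup>+ x. F y * \<phi> (y - A x) \<partial>lborel) = F y * \<gamma>"
        by (simp add: nn_integral_cmult)
    qed
    also have "\<dots> = (\<integral>\<^sup>+ x. F x \<partial>lborel) * \<gamma>"
      by (simp add: nn_integral_multc)
    finally show ?thesis .
  qed
  have "\<beta> * \<beta> = \<gamma> * \<gamma>"
    using key[of "\<lambda>x. \<phi> (A x)"] by (simp add: inv \<beta>_def \<gamma>_def)
  \<comment> \<open>A priori \<gamma> may be infinite; the case split rules this out, as \<beta> is
    finite.\<close>
  then have "\<beta> = \<gamma>"
    using \<beta>_fin
    by (cases \<beta>; cases \<gamma>)
      (auto simp: ennreal_mult_top ennreal_top_mult ennreal_power simp flip: power2_eq_square)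
  then have "\<beta> * (\<integral>\<^sup>+ x. F (A x) \<partial>lborel) = \<beta> * (\<integral>\<^sup>+ x. F x \<partial>lborel)"
    using key[OF F] by (simp add: mult.commute)
  then show ?thesis
    using \<beta>_fin \<beta>_pos by (auto simp: ennreal_mult_cancel_left)
qed

section \<open>The Minkowski form on time-space pairs and integration over the hyperboloid\<close>

text \<open>With the time coordinate split off as a pair component, Lebesgue measure is a product
  and Fubini applies.\<close>

definition lor :: "real \<times> 'a::euclidean_space \<Rightarrow> real \<times> 'a \<Rightarrow> real" where
  "lor p q = fst p * fst q - snd p \<bullet> snd q"

definition wt :: "'a::euclidean_space \<Rightarrow> real" where
  "wt x = sqrt (1 + x \<bullet> x)"

definition up :: "'a::euclidean_space \<Rightarrow> real \<times> 'a" where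
  "up x = (wt x, x)"

definition future :: "(real \<times> 'a::euclidean_space) set" where
  "future = {p. fst p > 0 \<and> lor p p > 0}"

text \<open>Integral over the unit hyperboloid against its invariant measure, in the chart of
  spatial coordinates. As \<open>ennreal\<close> sends negative reals to 0, only the positive part
  of \<open>G\<close> counts.\<close>

definition hyp_int :: "(real \<times> 'a::euclidean_space \<Rightarrow> real) \<Rightarrow> ennreal" where
  "hyp_int G = (\<integral>\<^sup>+ x. ennreal (G (up x) / wt x) \<partial>lborel)"

lemma wt_pos: "wt x > 0"
  by (simp add: wt_def add_pos_nonneg)

lemma wt_measurable [measurable]: "wt \<in> borel_measurable borel"
  unfolding wt_def by measurable

lemma lor_up: "lor (up x) (up x) = 1"
  by (simp add: lor_def up_def wt_def add_nonneg_nonneg flip: power2_eq_square)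

lemma up_future: "up x \<in> future"
  using lor_up[of x] by (simp add: future_def) (simp add: up_def wt_pos)

lemma up_snd:
  assumes "p \<in> future" "lor p p = 1" shows "up (snd p) = p"
proof -
  have "(fst p)\<^sup>2 = 1 + snd p \<bullet> snd p" "fst p > 0"
    using assms by (auto simp: lor_def future_def power2_eq_square)
  then have "wt (snd p) = fst p"
    by (simp add: wt_def real_sqrt_unique)
  then show ?thesis by (simp add: up_def)
qed

lemma lor_self_measurable [measurable]: "(\<lambda>p. lor p p) \<in> borel_measurable borel"
  unfolding lor_def by (intro borel_measurable_continuous_onI continuous_intros)

lemma future_sets [measurable]: "future \<in> sets borel"
  unfolding future_def lor_def
  by (intro borel_open open_Collect_conj open_Collect_less continuous_intros)

text \<open>
  Substitute \<open>t = sqrt (r\<^sup>2 + |z|\<^sup>2)\<close> in the time coordinate for fixed \<open>z\<close>, and then \<open>z = r x\<close> for fixed \<open>r\<close>.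
\<close>
lemma hyp_int_polar:
  fixes G :: "real \<times> 'a::euclidean_space \<Rightarrow> real"
  assumes [measurable]: "G \<in> borel_measurable borel"
  shows "(\<integral>\<^sup>+ p. ennreal (G ((1 / sqrt (lor p p)) *\<^sub>R p)) *
        indicator {p \<in> future. 1 \<le> lor p p \<and> lor p p \<le> 4} p \<partial>lborel)
     = (\<integral>\<^sup>+ r. ennreal (r ^ DIM('a)) * indicator {1..2} r \<partial>lborel) * hyp_int G" (is "?L = ?C * _")
proof -
  define F :: "real \<times> 'a \<Rightarrow> ennreal" where
    "F p = ennreal (G ((1 / sqrt (lor p p)) *\<^sub>R p)) *
      indicator {p \<in> future. 1 \<le> lor p p \<and> lor p p \<le> 4} p" for p
  define g :: "'a \<Rightarrow> real \<Rightarrow> real" where "g z r = sqrt (r\<^sup>2 + z \<bullet> z)" for z r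
  have Fm: "F \<in> borel_measurable borel"
    unfolding F_def by measurable
  have Fm': "F \<in> borel_measurable (lborel \<Otimes>\<^sub>M lborel)"
    using Fm by (simp add: lborel_prod)
  have g_pos: "g z r > 0" if "r > 0" for z r
    using that by (simp add: g_def add_pos_nonneg)
  have "?L = (\<integral>\<^sup>+ z. (\<integral>\<^sup>+ t. F (t, z) \<partial>lborel) \<partial>lborel)"
    using lborel_pair.nn_integral_snd[OF Fm']
    by (simp add: lborel_prod F_def[symmetric])
  \<comment> \<open>For \<open>r > 0\<close>, the future point with spatial part \<open>z\<close>
    and Minkowski norm \<open>r\<close> has time coordinate \<open>g z r\<close>, whose derivative
    in \<open>r\<close> is \<open>r / g z r\<close>.\<close>
  also have "\<dots> = (\<integral>\<^sup>+ z. (\<integral>\<^sup>+ r. ennreal (G ((1 / r) *\<^sub>R (g z r, z))) * ennreal (r / g z r) * indicator {1..2} r \<partial>lborel) \<partial>lborel)"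
  proof (rule nn_integral_cong)
    fix z :: 'a
    define f where "f t = ennreal (G ((1 / sqrt (lor (t, z) (t, z))) *\<^sub>R (t, z)))" for t
    have "F (t, z) = f t * indicator {g z 1 .. g z 2} t" for t
    proof -
      have "(t, z) \<in> {p \<in> future. 1 \<le> lor p p \<and> lor p p \<le> 4} \<longleftrightarrow> t \<in> {g z 1..g z 2}"
      proof -
        \<comment> \<open>Writing the absolute value as \<open>sqrt (t\<^sup>2)\<close> turns both
          bounds into comparisons of radicands.\<close>
        have "t \<in> {g z 1..g z 2} \<longleftrightarrow> t > 0 \<and> g z 1 \<le> \<bar>t\<bar> \<and> \<bar>t\<bar> \<le> g z 2"
          using g_pos[of 1 z] by auto
        also have "g z 1 \<le> \<bar>t\<bar> \<longleftrightarrow> 1 \<le> t\<^sup>2 - z \<bullet> z"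
          unfolding g_def real_sqrt_abs[symmetric] real_sqrt_le_iff by auto
        also have "\<bar>t\<bar> \<le> g z 2 \<longleftrightarrow> t\<^sup>2 - z \<bullet> z \<le> 4"
          unfolding g_def real_sqrt_abs[symmetric] real_sqrt_le_iff by auto
        finally show ?thesis
          by (auto simp: future_def lor_def power2_eq_square)
      qed
      then show ?thesis by (simp add: F_def f_def indicator_def)
    qed
    then have "(\<integral>\<^sup>+ t. F (t, z) \<partial>lborel) = (\<integral>\<^sup>+ t. f t * indicator {g z 1 .. g z 2} t \<partial>lborel)"
      by simp
    also have "\<dots> = (\<integral>\<^sup>+ r. f (g z r) * ennreal (r / g z r) * indicator {1..2} r \<partial>lborel)"
    proof (rule nn_integral_substitution_aux)
      show "f \<in> borel_measurable borel"
        unfolding f_def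
        by (rule measurable_compose[where N = borel and g = "\<lambda>p. ennreal (G ((1 / sqrt (lor p p)) *\<^sub>R p))"])
          (intro borel_measurable_continuous_onI continuous_intros, measurable)
      fix r :: real assume r: "r \<in> {1..2}"
      then have "0 < r\<^sup>2 + z \<bullet> z"
        by (intro add_pos_nonneg) auto
      then show "(g z has_real_derivative r / g z r) (at r)"
        unfolding g_def by (auto intro!: derivative_eq_intros simp: divide_simps)
      show "0 \<le> r / g z r" using r g_pos[of r z] by simp
    next
      have "r\<^sup>2 + z \<bullet> z \<noteq> 0" if "1 \<le> r" for r
        using that by (smt (verit) inner_ge_zero zero_less_power)
      then show "continuous_on {1..2} (\<lambda>r. r / g z r)"
        unfolding g_def by (intro continuous_intros) auto
    qed auto
    also have "\<dots> = (\<integral>\<^sup>+ r. ennreal (G ((1 / r) *\<^sub>R (g z r, z))) * ennreal (r / g z r) * indicator {1..2} r \<partial>lborel)"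
    proof (rule nn_integral_cong)
      fix r :: real
      have "sqrt (lor (g z r, z) (g z r, z)) = r" if "r \<ge> 1"
        using that by (simp add: lor_def g_def flip: power2_eq_square)
      then show "f (g z r) * ennreal (r / g z r) * indicator {1..2} r =
          ennreal (G ((1 / r) *\<^sub>R (g z r, z))) * ennreal (r / g z r) * indicator {1..2} r"
        by (auto simp: f_def indicator_def)
    qed
    finally show "(\<integral>\<^sup>+ t. F (t, z) \<partial>lborel) = \<dots>" .
  qed
  also have "\<dots> = (\<integral>\<^sup>+ r. (\<integral>\<^sup>+ z. ennreal (G ((1 / r) *\<^sub>R (g z r, z))) * ennreal (r / g z r) * indicator {1..2} r \<partial>lborel) \<partial>lborel)"
    unfolding g_def
    by (rule lborel_pair.Fubini') measurable
  also have "\<dots> = (\<integral>\<^sup>+ r. ennreal (r ^ DIM('a)) * indicator {1..2} r * hyp_int G \<partial>lborel)"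
  proof (rule nn_integral_cong)
    fix r :: real
    show "(\<integral>\<^sup>+ z. ennreal (G ((1 / r) *\<^sub>R (g z r, z))) * ennreal (r / g z r) * indicator {1..2} r \<partial>lborel)
       = ennreal (r ^ DIM('a)) * indicator {1..2} r * hyp_int G"
    proof (cases "r \<in> {1..2}")
      case True
      then have r: "r > 0" by simp
      \<comment> \<open>By this homogeneity the Jacobian \<open>r / g z r\<close> becomes
        \<open>1 / wt x\<close>, the weight in \<open>hyp_int\<close>.\<close>
      have g: "g (r *\<^sub>R x) r = r * wt x" for x
      proof -
        have "g (r *\<^sub>R x) r = sqrt (r\<^sup>2 * (1 + x \<bullet> x))"
          by (simp add: g_def power2_eq_square algebra_simps)
        also have "\<dots> = r * wt x" using r by (simp add: real_sqrt_mult wt_def)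
        finally show ?thesis .
      qed
      have "(\<integral>\<^sup>+ z. ennreal (G ((1 / r) *\<^sub>R (g z r, z))) * ennreal (r / g z r) * indicator {1..2} r \<partial>lborel)
         = ennreal (\<bar>r\<bar> ^ DIM('a)) * (\<integral>\<^sup>+ x. ennreal (G ((1 / r) *\<^sub>R (g (r *\<^sub>R x) r, r *\<^sub>R x))) * ennreal (r / g (r *\<^sub>R x) r) * indicator {1..2} r \<partial>lborel)"
        by (rule nn_integral_lborel_scale) (use r in \<open>simp_all add: g_def\<close>)
      also have "\<dots> = ennreal (r ^ DIM('a)) * hyp_int G"
        using r True
        by (simp add: g hyp_int_def up_def wt_pos less_imp_le ennreal_mult''[symmetric])
      finally show ?thesis using True by simp
    qed auto
  qed
  also have "\<dots> = ?C * hyp_int G"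
    by (rule nn_integral_multc) measurable
  finally show ?thesis .
qed

section \<open>The future cone and Minkowski reflections\<close>

lemma lor_sym: "lor p q = lor q p"
  by (simp add: lor_def inner_commute mult.commute)

lemma lor_add_left: "lor (p + q) r = lor p r + lor q r"
  by (simp add: lor_def inner_add_left algebra_simps)

lemma lor_diff_left: "lor (p - q) r = lor p r - lor q r"
  by (simp add: lor_def inner_diff_left algebra_simps)

lemma lor_diff_right: "lor r (p - q) = lor r p - lor r q"
  by (simp add: lor_def inner_diff_right algebra_simps)

lemma lor_scaleR_left: "lor (c *\<^sub>R p) q = c * lor p q"
  by (simp add: lor_def algebra_simps)

lemma lor_scaleR_right: "lor p (c *\<^sub>R q) = c * lor p q"
  by (simp add: lor_def algebra_simps)

lemma future_iff_norm: "p \<in> future \<longleftrightarrow> norm (snd p) < fst p"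
proof -
  have "p \<in> future \<longleftrightarrow> fst p > 0 \<and> (norm (snd p))\<^sup>2 < (fst p)\<^sup>2"
    by (simp add: future_def lor_def power2_norm_eq_inner) (simp add: power2_eq_square)
  also have "\<dots> \<longleftrightarrow> norm (snd p) < fst p"
    by (smt (verit) norm_ge_zero power2_less_imp_less power_strict_mono zero_less_numeral)
  finally show ?thesis .
qed

lemma lor_future_pos:
  assumes "p \<in> future" "q \<in> future"
  shows "lor p q > 0"
proof -
  have "snd p \<bullet> snd q \<le> norm (snd p) * norm (snd q)"
    by (rule norm_cauchy_schwarz)
  also have "\<dots> < fst p * fst q"
    using assms by (intro mult_strict_mono') (auto simp: future_iff_norm)
  finally show ?thesis by (simp add: lor_def)
qed

text \<open>A timelike vector outside the future cone has its negative inside, and two future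
  vectors have positive product.\<close>

lemma future_if_lor_pos:
  assumes "q \<in> future" "lor p p > 0" "lor p q > 0"
  shows "p \<in> future"
proof (rule ccontr)
  assume "p \<notin> future"
  then have "fst p \<le> 0"
    using assms by (auto simp: future_def)
  moreover have "lor p p \<le> 0" if "fst p = 0"
    using that by (simp add: lor_def)
  then have "fst p \<noteq> 0"
    using assms(2) by auto
  ultimately have "(-1) *\<^sub>R p \<in> future"
    using assms(2) by (simp add: future_def lor_def)
  from lor_future_pos[OF this assms(1)] show False
    using assms(3) unfolding lor_scaleR_left by simp
qed

text \<open>If \<open>m\<close> is the common square, the difference has square
  \<open>2 * (m - lor p q)\<close>, so strict reversed Cauchy-Schwarz is needed. Equal time
  coordinates are treated apart: the spatial norms then agree and the strict estimate below
  degenerates.\<close>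

lemma lor_diff_spacelike:
  assumes "p \<in> future" "q \<in> future" "lor p p = lor q q" "p \<noteq> q"
  shows "lor (p - q) (p - q) < 0"
proof (cases "fst p = fst q")
  case True
  then have "snd p \<noteq> snd q"
    using assms(4) by (simp add: prod_eq_iff)
  then show ?thesis
    using True by (simp add: lor_def)
next
  case False
  define m X Y where "m = lor p p" and "X = norm (snd p)" and "Y = norm (snd q)"
  have m: "m > 0" "(fst p)\<^sup>2 = m + X\<^sup>2" "(fst q)\<^sup>2 = m + Y\<^sup>2"
    unfolding m_def X_def Y_def power2_norm_eq_inner
    using assms by (auto simp: future_def lor_def power2_eq_square)
  have pos: "fst p > 0" "fst q > 0"
    using assms by (auto simp: future_def)
  have "X \<noteq> Y"
    using False pos m power2_eq_imp_eq[of "fst p" "fst q"] by auto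
  then have "0 < m * (X - Y)\<^sup>2"
    using m by simp
  also have "\<dots> = (fst p * fst q)\<^sup>2 - (m + X * Y)\<^sup>2"
    unfolding power_mult_distrib m by (simp add: power2_eq_square algebra_simps)
  finally have "(m + X * Y)\<^sup>2 < (fst p * fst q)\<^sup>2"
    by simp
  then have "m + X * Y < fst p * fst q"
    using pos by (auto intro: power2_less_imp_less)
  moreover have "snd p \<bullet> snd q \<le> X * Y"
    unfolding X_def Y_def by (rule norm_cauchy_schwarz)
  ultimately have "lor p q > m"
    by (simp add: lor_def)
  then show ?thesis
    using assms(3) by (simp add: lor_diff_left lor_diff_right lor_sym[of q p] m_def)
qed

text \<open>Reflection in the hyperplane Minkowski-orthogonal to \<open>v\<close>. For lightlike
  \<open>v\<close>, division by zero makes it the identity.\<close>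

definition lor_refl :: "real \<times> 'a::euclidean_space \<Rightarrow> real \<times> 'a \<Rightarrow> real \<times> 'a" where
  "lor_refl v p = p - (2 * lor p v / lor v v) *\<^sub>R v"

lemma linear_lor_refl: "linear (lor_refl v)"
  by (rule linearI)
    (simp_all add: lor_refl_def lor_add_left lor_scaleR_left algebra_simps add_divide_distrib)

lemma lor_refl_lor_refl:
  assumes "lor v v \<noteq> 0"
  shows "lor_refl v (lor_refl v p) = p"
proof -
  have "lor (lor_refl v p) v = - lor p v"
    using assms by (simp add: lor_refl_def lor_diff_left lor_scaleR_left)
  then show ?thesis
    by (simp add: lor_refl_def[of v "lor_refl v p"]) (simp add: lor_refl_def)
qed

text \<open>Both sides equal \<open>lor p q - 2 * lor p v * lor v q / lor v v\<close>.
  Self-adjointness and the involution property together make the reflection an isometry.\<close>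

lemma lor_lor_refl:
  assumes "lor v v \<noteq> 0"
  shows "lor (lor_refl v p) q = lor p (lor_refl v q)"
  by (simp add: lor_refl_def lor_diff_left lor_diff_right lor_scaleR_left lor_scaleR_right lor_sym[of v q])

text \<open>Equal squares make the coefficient in the reflection formula 1, so exactly
  \<open>p - q\<close> is subtracted from \<open>p\<close>.\<close>

lemma lor_refl_swap:
  assumes "lor p p = lor q q" "lor (p - q) (p - q) \<noteq> 0"
  shows "lor_refl (p - q) p = q"
proof -
  have "2 * lor p (p - q) = lor (p - q) (p - q)"
    using assms(1) by (simp add: lor_diff_left lor_diff_right lor_sym[of q p])
  then show ?thesis
    using assms(2) by (simp add: lor_refl_def)
qed

text \<open>The reflection is an isometry exchanging \<open>a\<close> and \<open>b\<close>, so the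
  image of \<open>p\<close> has the same positive product with \<open>b\<close> as \<open>p\<close>
  has with \<open>a\<close>.\<close>

lemma lor_refl_future:
  assumes a: "a \<in> future" "b \<in> future" "lor a a = lor b b" "a \<noteq> b" and p: "p \<in> future"
  shows "lor_refl (a - b) p \<in> future"
proof (rule future_if_lor_pos[OF a(2)])
  let ?R = "lor_refl (a - b)"
  have ne: "lor (a - b) (a - b) \<noteq> 0"
    using lor_diff_spacelike[OF a] by simp
  have "lor (?R p) (?R p) = lor p p"
    using ne by (simp add: lor_lor_refl lor_refl_lor_refl)
  then show "lor (?R p) (?R p) > 0"
    using p by (simp add: future_def)
  have "?R b = a"
    using lor_refl_swap[OF a(3) ne] lor_refl_lor_refl[OF ne, of a] by simp
  then have "lor (?R p) b = lor p a"
    using ne by (simp add: lor_lor_refl)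
  then show "lor (?R p) b > 0"
    using lor_future_pos[OF p a(1)] by simp
qed

section \<open>Invariance of the hyperboloid integral\<close>

text \<open>\<open>R\<close> preserves the cone shell and commutes with scaling to norm 1, so
  invariance of Lebesgue measure on the shell descends to the hyperboloid.\<close>

lemma hyp_int_invariant_measurable:
  fixes G :: "real \<times> 'a::euclidean_space \<Rightarrow> real"
  assumes R: "linear R" "\<And>p. R (R p) = p" "\<And>p. lor (R p) (R p) = lor p p"
      "\<And>p. p \<in> future \<Longrightarrow> R p \<in> future"
    and [measurable]: "G \<in> borel_measurable borel"
  shows "hyp_int (\<lambda>p. G (R p)) = hyp_int G"
proof -
  have [measurable]: "R \<in> borel_measurable borel"
    by (intro borel_measurable_continuous_onI linear_continuous_on
        linear_conv_bounded_linear[THEN iffD1] R)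
  define S :: "(real \<times> 'a) set" where "S = {p \<in> future. 1 \<le> lor p p \<and> lor p p \<le> 4}"
  define F where "F p = ennreal (G ((1 / sqrt (lor p p)) *\<^sub>R p)) * indicator S p" for p
  define C where "C = (\<integral>\<^sup>+ r. ennreal (r ^ DIM('a)) * indicator {1..2} r \<partial>lborel)"
  have [measurable]: "S \<in> sets borel"
    unfolding S_def by measurable
  have [measurable]: "F \<in> borel_measurable borel"
    unfolding F_def by measurable
  have S_iff: "R p \<in> S \<longleftrightarrow> p \<in> S" for p
    using R(2)[of p] R(3)[of p] R(4)[of p] R(4)[of "R p"] by (auto simp: S_def)
  have FR: "ennreal (G (R ((1 / sqrt (lor p p)) *\<^sub>R p))) * indicator S p = F (R p)" for p
    by (simp add: F_def R(3) linear_scale[OF R(1)] S_iff indicator_def)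
  have "C * hyp_int (\<lambda>p. G (R p)) = (\<integral>\<^sup>+ p. F (R p) \<partial>lborel)"
    unfolding FR[symmetric] S_def C_def by (rule hyp_int_polar[symmetric]) measurable
  also have "\<dots> = (\<integral>\<^sup>+ p. F p \<partial>lborel)"
    by (rule nn_integral_lborel_linear_involution[OF R(1,2)]) measurable
  also have "\<dots> = C * hyp_int G"
    unfolding F_def S_def C_def by (rule hyp_int_polar) measurable
  finally have eq: "C * hyp_int (\<lambda>p. G (R p)) = C * hyp_int G" .
  \<comment> \<open>\<open>C\<close> can be cancelled: the factor \<open>r ^ DIM('a)\<close> lies
    between 1 and \<open>2 ^ DIM('a)\<close> on an interval of length 1.\<close>
  have "(\<integral>\<^sup>+ r. indicator {1..2::real} r \<partial>lborel) \<le> C"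
    unfolding C_def by (intro nn_integral_mono) (auto simp: indicator_def one_le_power)
  then have "C \<noteq> 0" by auto
  moreover have "C \<le> (\<integral>\<^sup>+ r. ennreal (2 ^ DIM('a)) * indicator {1..2::real} r \<partial>lborel)"
    unfolding C_def by (intro nn_integral_mono) (auto simp: indicator_def intro!: ennreal_leI power_mono)
  then have "C \<noteq> top"
    by (auto simp: nn_integral_cmult_indicator top_unique)
  ultimately show ?thesis
    using eq by (simp add: ennreal_mult_cancel_left)
qed

text \<open>
  No measurability of \<open>G\<close> is available in the application: \<open>f\<close> is arbitrary outside the positive reals,
  and the sign of the normalizing constants is not established. So the integral of \<open>G \<circ> R\<close> is approximated
  from below by simple functions, which are transported back by \<open>R\<close>.
\<close>
lemma hyp_int_invariant_le:
  fixes G :: "real \<times> 'a::euclidean_space \<Rightarrow> real"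
  assumes R: "linear R" "\<And>p. R (R p) = p" "\<And>p. lor (R p) (R p) = lor p p"
      "\<And>p. p \<in> future \<Longrightarrow> R p \<in> future"
  shows "hyp_int (\<lambda>p. G (R p)) \<le> hyp_int G"
  unfolding hyp_int_def[of "\<lambda>p. G (R p)"] nn_integral_def_finite
proof (rule SUP_least, safe)
  fix s :: "'a \<Rightarrow> ennreal"
  assume s: "simple_function lborel s" and le: "s \<le> (\<lambda>x. ennreal (G (R (up x)) / wt x))"
    and fin: "\<forall>x. s x < top"
  have [measurable]: "R \<in> borel_measurable borel"
    by (intro borel_measurable_continuous_onI linear_continuous_on
        linear_conv_bounded_linear[THEN iffD1] R)
  have [measurable]: "(snd :: real \<times> 'a \<Rightarrow> 'a) \<in> borel_measurable borel"
    by (intro borel_measurable_continuous_onI continuous_intros)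
  have [measurable]: "s \<in> borel_measurable borel"
    using borel_measurable_simple_function[OF s] by simp
  \<comment> \<open>The weight is multiplied in so that \<open>H (up x) / wt x\<close> recovers
    \<open>s x\<close>; finiteness of \<open>s\<close> means that \<open>enn2real\<close> loses
    nothing.\<close>
  define H where "H p = enn2real (s (snd p)) * wt (snd p)" for p :: "real \<times> 'a"
  have [measurable]: "H \<in> borel_measurable borel"
    unfolding H_def by measurable
  have up_R: "up (snd (R (up x))) = R (up x)" for x
    by (rule up_snd) (simp_all add: R up_future lor_up)
  have "integral\<^sup>S lborel s = (\<integral>\<^sup>+ x. s x \<partial>lborel)"
    by (rule nn_integral_eq_simple_integral[OF s, symmetric])
  also have "\<dots> = hyp_int H"
    unfolding hyp_int_def
  proof (rule nn_integral_cong)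
    fix x :: 'a
    show "s x = ennreal (H (up x) / wt x)"
      using wt_pos[of x] fin by (simp add: H_def up_def)
  qed
  also have "\<dots> = hyp_int (\<lambda>p. H (R p))"
    by (rule hyp_int_invariant_measurable[OF R, symmetric]) measurable
  also have "\<dots> \<le> hyp_int G"
    unfolding hyp_int_def
  proof (rule nn_integral_mono)
    fix x :: 'a
    define y where "y = snd (R (up x))"
    have y: "R (up x) = up y" "R (up y) = up x"
      using up_R[of x] R(2)[of "up x"] by (simp_all add: y_def)
    \<comment> \<open>At \<open>y\<close> the function bounding \<open>s\<close> has numerator
      \<open>G (R (up y)) = G (up x)\<close>. The maximum with 0 below accounts for negative values,
      which \<open>ennreal\<close> truncates.\<close>
    have "s y \<le> ennreal (G (up x) / wt y)"
      using le[unfolded le_fun_def, rule_format, of y] y by simp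
    then have "enn2real (s y) \<le> max 0 (G (up x) / wt y)"
      by (simp add: enn2real_leI ennreal_max_0)
    then have "enn2real (s y) * wt y \<le> max 0 (G (up x) / wt y) * wt y"
      using wt_pos[of y] by (simp add: mult_right_mono)
    also have "\<dots> = max 0 (G (up x))"
      using wt_pos[of y] by (simp add: max_def zero_le_divide_iff divide_le_0_iff)
    finally have "H (R (up x)) \<le> max 0 (G (up x))"
      by (simp add: H_def y_def)
    then have "H (R (up x)) / wt x \<le> max 0 (G (up x)) / wt x"
      using wt_pos[of x] by (simp add: divide_right_mono)
    also have "\<dots> = max 0 (G (up x) / wt x)"
      using wt_pos[of x] by (simp add: max_def zero_le_divide_iff divide_le_0_iff)
    finally have "ennreal (H (R (up x)) / wt x) \<le> ennreal (max 0 (G (up x) / wt x))"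
      by (rule ennreal_leI)
    then show "ennreal (H (R (up x)) / wt x) \<le> ennreal (G (up x) / wt x)"
      by (simp only: ennreal_max_0)
  qed
  finally show "integral\<^sup>S lborel s \<le> hyp_int G" .
qed

text \<open>Self-adjointness moves \<open>R\<close> from the parameters to the integration variable.
  The one-sided estimate, applied to both integrands, yields equality because \<open>R\<close> is an
  involution.\<close>

lemma hyp_int_lor_refl:
  fixes \<Psi> :: "real \<Rightarrow> real \<Rightarrow> real"
  assumes a: "a \<in> future" "b \<in> future" "lor a a = lor b b" "a \<noteq> b"
  defines "R \<equiv> lor_refl (a - b)"
  shows "hyp_int (\<lambda>p. \<Psi> (lor (R c) p) (lor (R d) p)) = hyp_int (\<lambda>p. \<Psi> (lor c p) (lor d p))"
proof -
  have ne: "lor (a - b) (a - b) \<noteq> 0"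
    using lor_diff_spacelike[OF a] by simp
  have RR: "R (R p) = p" for p
    unfolding R_def by (rule lor_refl_lor_refl[OF ne])
  have RL: "lor (R p) q = lor p (R q)" for p q
    unfolding R_def by (rule lor_lor_refl[OF ne])
  have le: "hyp_int (\<lambda>p. G (R p)) \<le> hyp_int G" for G
  proof (rule hyp_int_invariant_le[where R = R and G = G])
    show "linear R"
      unfolding R_def by (rule linear_lor_refl)
    show "R p \<in> future" if "p \<in> future" for p
      unfolding R_def by (rule lor_refl_future[OF a that])
  qed (simp_all add: RL RR)
  show ?thesis
    using le[of "\<lambda>p. \<Psi> (lor c p) (lor d p)"] le[of "\<lambda>p. \<Psi> (lor (R c) p) (lor (R d) p)"]
    by (simp add: RL RR)
qed

lemma hyp_int_eq_if_same_lor: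
  fixes \<Psi> :: "real \<Rightarrow> real \<Rightarrow> real" and a b a' b' :: "real \<times> 'a::euclidean_space"
  assumes fut: "a \<in> future" "b \<in> future" "a' \<in> future" "b' \<in> future"
    and eq: "lor a a = lor a' a'" "lor b b = lor b' b'" "lor a b = lor a' b'"
  shows "hyp_int (\<lambda>p. \<Psi> (lor a p) (lor b p)) = hyp_int (\<lambda>p. \<Psi> (lor a' p) (lor b' p))"
proof -
  \<comment> \<open>Matches the second vector once the first is matched. It is stated for arbitrary
    \<open>b\<close> because it is also applied to the reflected vector.\<close>
  have step: "hyp_int (\<lambda>p. \<Psi> (lor a' p) (lor b p)) = hyp_int (\<lambda>p. \<Psi> (lor a' p) (lor b' p))"
    if "b \<in> future" "lor b b = lor b' b'" "lor a' b = lor a' b'" for b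
  proof (cases "b = b'")
    case False
    have ne: "lor (b - b') (b - b') \<noteq> 0"
      using lor_diff_spacelike[OF that(1) fut(4) that(2) False] by simp
    \<comment> \<open>The equal products with \<open>a'\<close> say that \<open>b - b'\<close> is
      orthogonal to \<open>a'\<close>.\<close>
    have "lor_refl (b - b') a' = a'"
      using that by (simp add: lor_refl_def lor_diff_right)
    then show ?thesis
      using hyp_int_lor_refl[OF that(1) fut(4) that(2) False, of \<Psi> a' b] lor_refl_swap[OF that(2) ne]
      by simp
  qed auto
  show ?thesis
  proof (cases "a = a'")
    case False
    let ?R = "lor_refl (a - a')"
    have ne: "lor (a - a') (a - a') \<noteq> 0"
      using lor_diff_spacelike[OF fut(1,3) eq(1) False] by simp
    have Ra: "?R a = a'"
      by (rule lor_refl_swap[OF eq(1) ne])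
    then have Ra': "?R a' = a"
      using lor_refl_lor_refl[OF ne, of a] by simp
    have "hyp_int (\<lambda>p. \<Psi> (lor a p) (lor b p)) = hyp_int (\<lambda>p. \<Psi> (lor a' p) (lor (?R b) p))"
      using hyp_int_lor_refl[OF fut(1,3) eq(1) False, of \<Psi> a b] Ra by simp
    also have "\<dots> = hyp_int (\<lambda>p. \<Psi> (lor a' p) (lor b' p))"
    proof (rule step)
      show "?R b \<in> future"
        by (rule lor_refl_future[OF fut(1,3) eq(1) False fut(2)])
      show "lor (?R b) (?R b) = lor b' b'"
        using eq by (simp add: lor_lor_refl[OF ne] lor_refl_lor_refl[OF ne])
      show "lor a' (?R b) = lor a' b'"
        using eq Ra' by (simp flip: lor_lor_refl[OF ne])
    qed
    finally show ?thesis .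
  next
    case True
    then show ?thesis
      using step[OF fut(2) eq(2)] eq(3) by simp
  qed
qed

section \<open>Transfer to coordinate vectors and the divergence\<close>

definition mink_pair :: "'d::finite mink_vec \<Rightarrow> real \<times> (real ^ 'd)" where
  "mink_pair x = (x $ None, \<chi> i. x $ Some i)"

lemma mink_eq_lor: "mink x y = lor (mink_pair x) (mink_pair y)"
  by (simp add: mink_def lor_def mink_pair_def inner_vec_def)

lemma Theta_iff_future: "\<theta> \<in> Theta \<longleftrightarrow> mink_pair \<theta> \<in> future"
  by (simp add: Theta_iff future_def mink_eq_lor) (simp add: mink_pair_def)

lemma mink_pair_lift: "mink_pair (lift x) = up x"
  by (simp add: mink_pair_def lift_def up_def wt_def inner_vec_def power2_eq_square)

text \<open>Both densities contain the factor \<open>1 / wt x\<close>, which cancels in their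
  quotient and remains once in front. The rest depends on \<open>x\<close> only through its products
  with the two parameters, and on the parameter norms through the constants.\<close>

lemma f_divergence_eq_if_same_mink:
  fixes a b a' b' :: "'d::finite mink_vec"
  assumes "a \<in> Theta" "b \<in> Theta" "a' \<in> Theta" "b' \<in> Theta"
    and "mink a a = mink a' a'" "mink b b = mink b' b'" "mink a b = mink a' b'"
  shows "f_divergence f (hyperboloid_density a) (hyperboloid_density b) =
     f_divergence f (hyperboloid_density a') (hyperboloid_density b')"
proof -
  define h where "h \<alpha> \<beta> s t = (let P = hyperboloid_const CARD('d) \<alpha> * exp (- s);
      Q = hyperboloid_const CARD('d) \<beta> * exp (- t) in P * f (Q / P))" for \<alpha> \<beta> s t
  have integrand: "hyperboloid_density \<theta> x * f (hyperboloid_density \<theta>' x / hyperboloid_density \<theta> x)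
      = h (mink_norm \<theta>) (mink_norm \<theta>') (lor (mink_pair \<theta>) (up x)) (lor (mink_pair \<theta>') (up x)) / wt x"
    for \<theta> \<theta>' :: "'d mink_vec" and x
  proof -
    have "hyperboloid_density \<theta> x
        = hyperboloid_const CARD('d) (mink_norm \<theta>) * exp (- lor (mink_pair \<theta>) (up x)) / wt x" for \<theta>
      by (simp add: hyperboloid_density_def mink_eq_lor mink_pair_lift wt_def inner_vec_def power2_eq_square)
    then show ?thesis
      using wt_pos[of x] by (simp add: h_def Let_def)
  qed
  \<comment> \<open>The integrals for \<open>h\<close> and \<open>- h\<close> are those of the
    positive and the negative part.\<close>
  have div: "f_divergence f (hyperboloid_density \<theta>) (hyperboloid_density \<theta>') =
      enn2ereal (hyp_int (\<lambda>p. h (mink_norm \<theta>) (mink_norm \<theta>') (lor (mink_pair \<theta>) p) (lor (mink_pair \<theta>') p))) -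
      enn2ereal (hyp_int (\<lambda>p. - h (mink_norm \<theta>) (mink_norm \<theta>') (lor (mink_pair \<theta>) p) (lor (mink_pair \<theta>') p)))"
    for \<theta> \<theta>' :: "'d mink_vec"
    by (simp add: f_divergence_def hyp_int_def integrand)
  have norms: "mink_norm a = mink_norm a'" "mink_norm b = mink_norm b'"
    using assms by (simp_all add: mink_norm_def)
  have "hyp_int (\<lambda>p. \<Psi> (lor (mink_pair a) p) (lor (mink_pair b) p))
      = hyp_int (\<lambda>p. \<Psi> (lor (mink_pair a') p) (lor (mink_pair b') p))" for \<Psi>
    by (rule hyp_int_eq_if_same_lor) (use assms in \<open>simp_all add: Theta_iff_future mink_eq_lor\<close>)
  from this[of "h (mink_norm a') (mink_norm b')"] this[of "\<lambda>s t. - h (mink_norm a') (mink_norm b') s t"]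
  show ?thesis
    by (simp add: div norms)
qed

theorem theorem2:
  fixes f :: "real \<Rightarrow> real"
  assumes "CARD('d::finite) \<ge> 2"
    and "convex_on {0<..} f"
    and "f 1 = 0"
  shows "(\<forall>A\<in>(SO0_1d :: 'd mink_mat set). \<forall>\<theta>\<in>Theta. \<forall>\<theta>'\<in>Theta.
            f_divergence f (hyperboloid_density (A *v \<theta>)) (hyperboloid_density (A *v \<theta>')) =
            f_divergence f (hyperboloid_density \<theta>) (hyperboloid_density \<theta>'))
       \<and> (\<exists>\<Phi> :: real \<Rightarrow> real \<Rightarrow> real \<Rightarrow> ereal.
            \<forall>\<theta>\<in>(Theta :: 'd mink_vec set). \<forall>\<theta>'\<in>Theta.
            f_divergence f (hyperboloid_density \<theta>) (hyperboloid_density \<theta>') =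
            \<Phi> (mink \<theta> \<theta>) (mink \<theta>' \<theta>') (mink \<theta> \<theta>'))"
proof (intro conjI ballI)
  fix A :: "'d mink_mat" and \<theta> \<theta>' :: "'d mink_vec"
  assume "A \<in> SO0_1d" "\<theta> \<in> Theta" "\<theta>' \<in> Theta"
  then show "f_divergence f (hyperboloid_density (A *v \<theta>)) (hyperboloid_density (A *v \<theta>')) =
      f_divergence f (hyperboloid_density \<theta>) (hyperboloid_density \<theta>')"
    by (intro f_divergence_eq_if_same_mink SO0_1d_Theta) (auto simp: SO0_1d_def SO_1d_def)
next
  define D where "D a b = f_divergence f (hyperboloid_density a) (hyperboloid_density b)"
    for a b :: "'d mink_vec"
  \<comment> \<open>The value is read off from any pair realizing the triple; the previous lemma
    makes it independent of the pair. Triples that no pair realizes get an arbitrary value.\<close>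
  define \<Phi> where "\<Phi> r s t = (SOME y. \<exists>a\<in>Theta. \<exists>b\<in>Theta.
      mink a a = r \<and> mink b b = s \<and> mink a b = t \<and> y = D a b)" for r s t
  have "D a b = \<Phi> (mink a a) (mink b b) (mink a b)" if "a \<in> Theta" "b \<in> Theta" for a b
    unfolding \<Phi>_def
  proof (rule some_equality[symmetric])
    show "\<exists>a'\<in>Theta. \<exists>b'\<in>Theta. mink a' a' = mink a a \<and> mink b' b' = mink b b
        \<and> mink a' b' = mink a b \<and> D a b = D a' b'"
      using that by blast
  next
    fix y
    assume "\<exists>a'\<in>Theta. \<exists>b'\<in>Theta. mink a' a' = mink a a \<and> mink b' b' = mink b b
        \<and> mink a' b' = mink a b \<and> y = D a' b'"
    then obtain a' b' where "a' \<in> Theta" "b' \<in> Theta" "mink a' a' = mink a a"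
        "mink b' b' = mink b b" "mink a' b' = mink a b" "y = D a' b'"
      by blast
    then show "y = D a b"
      using f_divergence_eq_if_same_mink[of a' b' a b f] that by (simp add: D_def)
  qed
  then show "\<exists>\<Phi> :: real \<Rightarrow> real \<Rightarrow> real \<Rightarrow> ereal.
      \<forall>\<theta>\<in>(Theta :: 'd mink_vec set). \<forall>\<theta>'\<in>Theta.
      f_divergence f (hyperboloid_density \<theta>) (hyperboloid_density \<theta>') =
      \<Phi> (mink \<theta> \<theta>) (mink \<theta>' \<theta>') (mink \<theta> \<theta>')"
    unfolding D_def by blast
qed

end
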